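(* Let $H$ be a Hilbert space and let $A \in \mathcal{B}(H)$ be a supraposinormal operator on $H$ with $AQA^* = A^*PA$, where $P, Q \in \mathcal{B}(H)$ are positive operators, at least one of which has dense range. If $Q \geq I \geq P \geq 0$, then $A$ is hyponormal.
   Context: $\mathcal{B}(H)$ denotes the bounded linear operators on the Hilbert space $H$, and $I$ is the identity. An operator $T$ is positive ($T \ge 0$) if it is self-adjoint and $\langle Tf,f\rangle \ge 0$ for all $f \in H$; $S \ge T$ means $S - T \ge 0$. An operator $A \in \mathcal{B}(H)$ is supraposinormal if there exist positive operators $P, Q \in \mathcal{B}(H)$ such that $AQA^* = A^*PA$, where at least one of $P$, $Q$ has dense range. An operator $A \in \mathcal{B}(H)$ is hyponormal if $\langle (A^*A - AA^* )f, f\rangle \geq 0$ for all $f \in H$. *)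

theory Defs
  imports "HOL-Analysis.Analysis"
begin

section \<open>Complex Hilbert spaces\<close>

class complex_vector = real_vector +
  fixes scaleC :: "complex \<Rightarrow> 'a \<Rightarrow> 'a" (infixr "*\<^sub>C" 75)
  assumes scaleC_add_right: "c *\<^sub>C (x + y) = c *\<^sub>C x + c *\<^sub>C y"
    and scaleC_add_left: "(c + d) *\<^sub>C x = c *\<^sub>C x + d *\<^sub>C x"
    and scaleC_scaleC: "c *\<^sub>C d *\<^sub>C x = (c * d) *\<^sub>C x"
    and scaleC_one: "1 *\<^sub>C x = x"
    and scaleR_scaleC: "r *\<^sub>R x = complex_of_real r *\<^sub>C x"

text \<open>The inner product is linear in its first and conjugate-linear in its second argument.\<close>

class complex_inner = complex_vector + real_normed_vector +
  fixes cinner :: "'a \<Rightarrow> 'a \<Rightarrow> complex"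
  assumes cinner_commute: "cinner x y = cnj (cinner y x)"
    and cinner_add_left: "cinner (x + y) z = cinner x z + cinner y z"
    and cinner_scaleC_left: "cinner (c *\<^sub>C x) y = c * cinner x y"
    and cinner_ge_zero: "cinner x x \<in> \<real>\<^sub>\<ge>\<^sub>0"
    and cinner_eq_zero_iff: "cinner x x = 0 \<longleftrightarrow> x = 0"
    and norm_eq_sqrt_cinner: "norm x = sqrt (Re (cinner x x))"

class complex_hilbert_space = complex_inner + complete_space

instantiation complex :: complex_hilbert_space
begin

definition scaleC_complex :: "complex \<Rightarrow> complex \<Rightarrow> complex"
  where "scaleC_complex c x = c * x"

definition cinner_complex :: "complex \<Rightarrow> complex \<Rightarrow> complex"
  where "cinner_complex x y = x * cnj y"

instance
  by standard
    (auto simp: scaleC_complex_def cinner_complex_def algebra_simps scaleR_conv_of_real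
      complex_nonneg_Reals_iff cmod_def power2_eq_square)

end

section \<open>Bounded operators\<close>

definition bounded_op :: "('a::complex_inner \<Rightarrow> 'a) \<Rightarrow> bool"
  where "bounded_op T \<longleftrightarrow> bounded_linear T \<and> (\<forall>c x. T (c *\<^sub>C x) = c *\<^sub>C T x)"

text \<open>On a Hilbert space, the adjoint of a bounded operator exists and is unique by the
  Riesz representation theorem; the value is unspecified for other arguments.\<close>

definition adj :: "('a::complex_hilbert_space \<Rightarrow> 'a) \<Rightarrow> 'a \<Rightarrow> 'a"
  where "adj T = (THE S. bounded_op S \<and> (\<forall>x y. cinner (T x) y = cinner x (S y)))"

definition positive_op :: "('a::complex_hilbert_space \<Rightarrow> 'a) \<Rightarrow> bool"
  where "positive_op T \<longleftrightarrow>
    bounded_op T \<and> adj T = T \<and> (\<forall>f. cinner (T f) f \<in> \<real>\<^sub>\<ge>\<^sub>0)"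

definition op_ge :: "('a::complex_hilbert_space \<Rightarrow> 'a) \<Rightarrow> ('a \<Rightarrow> 'a) \<Rightarrow> bool"
  where "op_ge S T \<longleftrightarrow> positive_op (\<lambda>f. S f - T f)"

definition dense_range :: "('a::complex_hilbert_space \<Rightarrow> 'a) \<Rightarrow> bool"
  where "dense_range T \<longleftrightarrow> closure (range T) = UNIV"

definition supraposinormal :: "('a::complex_hilbert_space \<Rightarrow> 'a) \<Rightarrow> bool"
  where "supraposinormal A \<longleftrightarrow> bounded_op A \<and>
    (\<exists>P Q. positive_op P \<and> positive_op Q \<and> (dense_range P \<or> dense_range Q) \<and>
      A \<circ> Q \<circ> adj A = adj A \<circ> P \<circ> A)"

definition hyponormal :: "('a::complex_hilbert_space \<Rightarrow> 'a) \<Rightarrow> bool"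
  where "hyponormal A \<longleftrightarrow> bounded_op A \<and>
    (\<forall>f. cinner (adj A (A f) - A (adj A f)) f \<in> \<real>\<^sub>\<ge>\<^sub>0)"

end

theory Submission
  imports Defs
begin

text \<open>For every \<open>f\<close> one has
  \<open>\<parallel>A f\<parallel>\<^sup>2 \<ge> \<langle>P A f, A f\<rangle> = \<langle>A\<^sup>* P A f, f\<rangle> = \<langle>A Q A\<^sup>* f, f\<rangle> = \<langle>Q A\<^sup>* f, A\<^sup>* f\<rangle> \<ge> \<parallel>A\<^sup>* f\<parallel>\<^sup>2\<close>.
  The adjoint comes from the Riesz representation theorem, which is obtained by minimising
  \<open>\<parallel>x\<parallel>\<^sup>2 - 2 \<phi> x\<close> for a real bounded functional \<open>\<phi>\<close>: minimising sequences are Cauchy by the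
  parallelogram law, and the first variation at the minimiser vanishes.\<close>

lemma cinner_add_right: "cinner x (y + z) = cinner x y + cinner x (z::'a::complex_inner)"
  by (metis cinner_add_left cinner_commute complex_cnj_add)

lemma cinner_scaleC_right: "cinner x (c *\<^sub>C y) = cnj c * cinner x (y::'a::complex_inner)"
  by (metis cinner_commute cinner_scaleC_left complex_cnj_mult)

lemma cinner_scaleR_left: "cinner (r *\<^sub>R x) y = of_real r * cinner x (y::'a::complex_inner)"
  by (simp add: scaleR_scaleC cinner_scaleC_left)

lemma cinner_scaleR_right: "cinner x (r *\<^sub>R y) = of_real r * cinner x (y::'a::complex_inner)"
  by (simp add: scaleR_scaleC cinner_scaleC_right)

lemma cinner_diff_left: "cinner (x - y) z = cinner x z - cinner y (z::'a::complex_inner)"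
  using cinner_add_left[of "x - y" y z] by simp

lemma cinner_diff_right: "cinner x (y - z) = cinner x y - cinner x (z::'a::complex_inner)"
  using cinner_add_right[of x "y - z" z] by simp

lemma cinner_self: "cinner x (x::'a::complex_inner) = of_real ((norm x)\<^sup>2)"
  using cinner_ge_zero[of x]
  by (auto simp: norm_eq_sqrt_cinner complex_nonneg_Reals_iff complex_eq_iff)

lemma Re_cinner_commute: "Re (cinner x y) = Re (cinner y (x::'a::complex_inner))"
  by (subst cinner_commute) simp

lemma norm_add_sq:
  "(norm (x + y))\<^sup>2 = (norm x)\<^sup>2 + 2 * Re (cinner x y) + (norm (y::'a::complex_inner))\<^sup>2"
proof -
  have "(norm (x + y))\<^sup>2 = Re (cinner (x + y) (x + y))"
    by (simp add: cinner_self)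
  also have "\<dots> = (norm x)\<^sup>2 + Re (cinner x y) + Re (cinner y x) + (norm y)\<^sup>2"
    by (simp only: cinner_add_left cinner_add_right) (simp add: cinner_self)
  finally show ?thesis
    using Re_cinner_commute[of x y] by simp
qed

text \<open>The type class already supplies the triangle inequality, so the Cauchy-Schwarz bound for
  the real part follows by squaring it and cancelling the squared norms.\<close>

lemma Re_cinner_le_norm: "Re (cinner x y) \<le> norm x * norm (y::'a::complex_inner)"
proof -
  have "(norm (x + y))\<^sup>2 \<le> (norm x + norm y)\<^sup>2"
    by (intro power_mono norm_triangle_ineq norm_ge_zero)
  then show ?thesis
    by (simp add: norm_add_sq power2_sum)
qed

lemma abs_Re_cinner_le_norm: "\<bar>Re (cinner x y)\<bar> \<le> norm x * norm (y::'a::complex_inner)"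
  \<comment> \<open>The lower bound is the upper bound at \<open>- x\<close>; the two instances of
    \<open>cinner_diff_left\<close> give \<open>cinner 0 y = 0\<close> and pull the sign out of
    \<open>cinner (- x) y\<close>.\<close>
  using Re_cinner_le_norm[of x y] Re_cinner_le_norm[of "- x" y] cinner_diff_left[of 0 x y]
    cinner_diff_left[of 0 0 y]
  by simp

lemma bounded_linear_Re_cinner_left: "bounded_linear (\<lambda>x. Re (cinner x (y::'a::complex_inner)))"
  by (rule bounded_linear_intro[where K = "norm y"])
    (simp_all add: cinner_add_left cinner_scaleR_left abs_Re_cinner_le_norm)

lemma parallelogram_law:
  "(norm (x + y))\<^sup>2 + (norm (x - y))\<^sup>2 = 2 * (norm x)\<^sup>2 + 2 * (norm (y::'a::complex_inner))\<^sup>2"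
  using norm_add_sq[of x y] norm_add_sq[of "x - y" y]
  by (simp add: cinner_diff_left cinner_self)

text \<open>Testing against \<open>a - b\<close> itself suffices. This yields both the linearity and
  the uniqueness of the adjoint.\<close>

lemma cinner_eqI:
  fixes a b :: "'a::complex_inner"
  assumes "\<And>x. cinner x a = cinner x b"
  shows "a = b"
  using assms[of "a - b"] cinner_diff_right[of "a - b" a b] cinner_eq_zero_iff[of "a - b"]
  by simp

text \<open>A quadratic without constant term changes sign at 0 unless its linear coefficient
  vanishes. This turns minimality along a line into a vanishing first variation.\<close>

lemma linear_coeff_zero:
  fixes a b :: real
  assumes "\<And>t. 0 \<le> a * t\<^sup>2 + b * t"
  shows "b = 0"
proof (rule ccontr)
  assume b: "b \<noteq> 0"
  \<comment> \<open>Any positive \<open>c\<close> above \<open>a\<close> makes the value at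
    \<open>- (b / c)\<close> negative; the absolute value covers both signs of
    \<open>a\<close>.\<close>
  define c where "c = \<bar>a\<bar> + 1"
  have c: "c > 0" "a < c" by (auto simp: c_def)
  have "a * (- (b / c))\<^sup>2 + b * (- (b / c)) = b\<^sup>2 / c\<^sup>2 * (a - c)"
    using c by (simp add: field_simps power2_eq_square)
  moreover have "b\<^sup>2 / c\<^sup>2 * (a - c) < 0"
    using b c by (intro mult_pos_neg) auto
  ultimately show False
    using assms[of "- (b / c)"] by linarith
qed

text \<open>Minimisation needs a real-valued objective, so only real functionals are represented
  here; \<open>adjoint_exists\<close> recovers the complex identity.\<close>

lemma Riesz_representation_Re:
  fixes \<phi> :: "'a::complex_hilbert_space \<Rightarrow> real"
  assumes "bounded_linear \<phi>"
  obtains z where "\<And>x. \<phi> x = Re (cinner x z)"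
proof -
  interpret \<phi>: bounded_linear \<phi> by fact
  define F where "F x = (norm x)\<^sup>2 - 2 * \<phi> x" for x
  define m where "m = (INF x. F x)"
  obtain K where K: "\<And>x. norm (\<phi> x) \<le> norm x * K"
    using \<phi>.bounded by blast
  have "- K\<^sup>2 \<le> F x" for x
  proof -
    \<comment> \<open>Completing the square: \<open>F x\<close> is at least
      \<open>(norm x)\<^sup>2 - 2 * K * norm x\<close>.\<close>
    have "0 \<le> (norm x - K)\<^sup>2" by simp
    then show ?thesis
      using K[of x] unfolding F_def power2_diff by (simp add: abs_le_iff)
  qed
  then have bdd: "bdd_below (range F)"
    by (rule bdd_belowI2)
  have mF: "m \<le> F x" for x
    unfolding m_def by (rule cINF_lower[OF bdd]) simp
  have "\<exists>x. F x < m + 1 / real (Suc n)" for n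
    using cINF_less_iff[OF _ bdd, of "m + 1 / real (Suc n)"] by (simp add: m_def)
  then obtain X where X: "\<And>n. F (X n) < m + 1 / real (Suc n)"
    by metis
  \<comment> \<open>The linear terms of \<open>F\<close> cancel, which leaves the parallelogram
    law.\<close>
  have midpoint: "(norm (x - y))\<^sup>2 / 2 = F x + F y - 2 * F ((1/2) *\<^sub>R (x + y))" for x y
    using parallelogram_law[of x y]
    by (simp add: F_def \<phi>.add \<phi>.scale power_mult_distrib power_divide add_divide_distrib)
  \<comment> \<open>The midpoint value is at least \<open>m\<close>, so the distance is controlled
    by how far \<open>F (X i)\<close> and \<open>F (X j)\<close> exceed \<open>m\<close>.\<close>
  have close: "(norm (X i - X j))\<^sup>2 < 2 / real (Suc i) + 2 / real (Suc j)" for i j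
    using midpoint[of "X i" "X j"] mF[of "(1/2) *\<^sub>R (X i + X j)"] X[of i] X[of j] by simp
  have "Cauchy X"
  proof (rule metric_CauchyI)
    fix e :: real assume e: "e > 0"
    then obtain N where N: "inverse (real (Suc N)) < e\<^sup>2 / 4"
      using reals_Archimedean[of "e\<^sup>2 / 4"] by auto
    have small: "2 / real (Suc i) < e\<^sup>2 / 2" if "i \<ge> N" for i
    proof -
      have "inverse (real (Suc i)) \<le> inverse (real (Suc N))"
        using that by (intro le_imp_inverse_le) auto
      then have "2 * inverse (real (Suc i)) < e\<^sup>2 / 2" using N by linarith
      then show ?thesis by (simp only: divide_inverse[of 2 "real (Suc i)"])
    qed
    have "dist (X i) (X j) < e" if "i \<ge> N" "j \<ge> N" for i j
    proof (rule power_less_imp_less_base)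
      show "(dist (X i) (X j))\<^sup>2 < e\<^sup>2"
        using close[of i j] small[OF that(1)] small[OF that(2)] by (simp add: dist_norm)
    qed (use e in simp)
    then show "\<exists>N. \<forall>i\<ge>N. \<forall>j\<ge>N. dist (X i) (X j) < e" by blast
  qed
  then obtain z where z: "X \<longlonglongrightarrow> z"
    using Cauchy_convergent convergent_def by blast
  have "(\<lambda>n. F (X n)) \<longlonglongrightarrow> F z"
    unfolding F_def by (intro tendsto_intros z \<phi>.tendsto)
  moreover have "(\<lambda>n. m + 1 / real (Suc n)) \<longlonglongrightarrow> m + 0"
    by (intro tendsto_intros LIMSEQ_Suc lim_1_over_n)
  ultimately have "F z \<le> m + 0"
    by (rule LIMSEQ_le) (use X less_imp_le in blast)
  then have min: "F z \<le> F x" for x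
    using mF[of x] by simp
  have "\<phi> h = Re (cinner h z)" for h
  proof -
    \<comment> \<open>The right-hand side is \<open>F (z + t *\<^sub>R h) - F z\<close>.\<close>
    have "0 \<le> (norm h)\<^sup>2 * t\<^sup>2 + (2 * (Re (cinner h z) - \<phi> h)) * t" for t
      using min[of "z + t *\<^sub>R h"] Re_cinner_commute[of z h]
      by (simp add: F_def norm_add_sq \<phi>.add \<phi>.scale cinner_scaleR_right power_mult_distrib
          algebra_simps)
    from linear_coeff_zero[OF this] show ?thesis by simp
  qed
  then show thesis by (rule that)
qed

lemma adjoint_exists:
  fixes T :: "'a::complex_hilbert_space \<Rightarrow> 'a"
  assumes "bounded_op T"
  shows "\<exists>S. bounded_op S \<and> (\<forall>x y. cinner (T x) y = cinner x (S y))"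
proof -
  have T: "bounded_linear T" and TC: "\<And>c x. T (c *\<^sub>C x) = c *\<^sub>C T x"
    using assms by (auto simp: bounded_op_def)
  have "\<exists>z. \<forall>x. cinner (T x) y = cinner x z" for y
  proof -
    obtain z where z: "\<And>x. Re (cinner (T x) y) = Re (cinner x z)"
      using Riesz_representation_Re[OF bounded_linear_compose[OF bounded_linear_Re_cinner_left T]]
      by metis
    \<comment> \<open>Since Re (i w) = - Im w, the real identity at \<open>\<i> *\<^sub>C x\<close>
      gives the imaginary parts at \<open>x\<close>.\<close>
    have "Im (cinner (T x) y) = Im (cinner x z)" for x
      using z[of "\<i> *\<^sub>C x"] by (simp add: TC cinner_scaleC_left)
    then show ?thesis
      using z complex_eq_iff by blast
  qed
  then obtain S where S: "\<And>x y. cinner (T x) y = cinner x (S y)"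
    by metis
  have add: "S (a + b) = S a + S b" for a b
    by (rule cinner_eqI) (simp add: cinner_add_right flip: S)
  have scaleC: "S (c *\<^sub>C a) = c *\<^sub>C S a" for c a
    by (rule cinner_eqI) (simp add: cinner_scaleC_right flip: S)
  obtain K where K: "K > 0" "\<And>x. norm (T x) \<le> norm x * K"
    using bounded_linear.pos_bounded[OF T] by blast
  \<comment> \<open>Pair \<open>S y\<close> with itself, move one factor across to \<open>T\<close>,
    and cancel \<open>norm (S y)\<close>, which must be nonzero for this.\<close>
  have bound: "norm (S y) \<le> norm y * K" for y
  proof (cases "S y = 0")
    case True
    then show ?thesis using K(1) by simp
  next
    case False
    have "norm (S y) * norm (S y) = Re (cinner (T (S y)) y)"
      by (simp add: S cinner_self power2_eq_square)
    also have "\<dots> \<le> norm (T (S y)) * norm y"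
      by (rule Re_cinner_le_norm)
    also have "\<dots> \<le> norm (S y) * K * norm y"
      by (intro mult_right_mono K norm_ge_zero)
    finally show ?thesis
      using False by (simp add: mult.commute mult.left_commute)
  qed
  have "bounded_linear S"
    by (rule bounded_linear_intro[OF add _ bound]) (simp add: scaleR_scaleC scaleC)
  then show ?thesis
    using S scaleC by (auto simp: bounded_op_def)
qed

text \<open>This discharges the definite description in \<open>adj\<close>:
  \<open>adjoint_exists\<close> gives existence and \<open>cinner_eqI\<close> uniqueness.\<close>

lemma cinner_adj_right:
  fixes T :: "'a::complex_hilbert_space \<Rightarrow> 'a"
  assumes "bounded_op T"
  shows "cinner x (adj T y) = cinner (T x) y"
proof -
  obtain S where S: "bounded_op S" "\<And>x y. cinner (T x) y = cinner x (S y)"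
    using adjoint_exists[OF assms] by blast
  have "adj T = S"
    unfolding adj_def
  proof (rule the_equality)
    fix R assume R: "bounded_op R \<and> (\<forall>x y. cinner (T x) y = cinner x (R y))"
    have "R y = S y" for y
      by (rule cinner_eqI) (metis R S(2))
    then show "R = S" by (rule ext)
  qed (use S in blast)
  then show ?thesis using S(2) by simp
qed

lemma cinner_adj_left:
  fixes T :: "'a::complex_hilbert_space \<Rightarrow> 'a"
  assumes "bounded_op T"
  shows "cinner (adj T x) y = cinner x (T y)"
  by (metis assms cinner_adj_right cinner_commute)

lemma op_ge_imp_Re_cinner_le: "op_ge S T \<Longrightarrow> Re (cinner (T f) f) \<le> Re (cinner (S f) f)"
  by (auto simp: op_ge_def positive_op_def complex_nonneg_Reals_iff cinner_diff_left)

theorem theorem1p2: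
  fixes A P Q :: "'a::complex_hilbert_space \<Rightarrow> 'a"
  assumes "supraposinormal A"
    and "positive_op P" and "positive_op Q"
    and "dense_range P \<or> dense_range Q"
    and "A \<circ> Q \<circ> adj A = adj A \<circ> P \<circ> A"
    and "op_ge Q id" and "op_ge id P" and "op_ge P (\<lambda>_. 0)"
  shows "hyponormal A"
proof -
  have A: "bounded_op A"
    using assms(1) by (simp add: supraposinormal_def)
  have "cinner (adj A (A f) - A (adj A f)) f \<in> \<real>\<^sub>\<ge>\<^sub>0" for f
  proof -
    have "(norm (adj A f))\<^sup>2 \<le> Re (cinner (Q (adj A f)) (adj A f))"
      using op_ge_imp_Re_cinner_le[OF assms(6), of "adj A f"] by (simp add: cinner_self)
    \<comment> \<open>Moving \<open>adj A\<close> across turns the left side into the pairing of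
      \<open>A (Q (adj A f))\<close> with \<open>f\<close>, where the operator identity
      applies.\<close>
    also have "\<dots> = Re (cinner (adj A (P (A f))) f)"
      using fun_cong[OF assms(5), of f] by (simp add: cinner_adj_right[OF A])
    also have "\<dots> = Re (cinner (P (A f)) (A f))"
      by (simp add: cinner_adj_left[OF A])
    also have "\<dots> \<le> (norm (A f))\<^sup>2"
      using op_ge_imp_Re_cinner_le[OF assms(7), of "A f"] by (simp add: cinner_self)
    finally have "(norm (adj A f))\<^sup>2 \<le> (norm (A f))\<^sup>2" .
    \<comment> \<open>Membership in the nonnegative reals also demands a zero imaginary part, hence
      an equation between complex numbers.\<close>
    moreover have "cinner (adj A (A f) - A (adj A f)) f
        = of_real ((norm (A f))\<^sup>2 - (norm (adj A f))\<^sup>2)"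
      by (simp add: cinner_diff_left cinner_adj_left[OF A] cinner_self
          flip: cinner_adj_right[OF A])
    ultimately show ?thesis
      by (simp add: complex_nonneg_Reals_iff)
  qed
  then show ?thesis
    using A by (simp add: hyponormal_def)
qed

end
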